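(* Let $C$ be a nonempty convex compact subset of $\mathbb{R}$. Let $T : C \to 2^{\mathbb{R}}$ be an upper semicontinuous set-valued mapping such that $T(x)$ is a nonempty compact convex subset of $\mathbb{R}$ for all $x \in C$. If $C \subseteq T(C)$, where $T(C) = \bigcup_{x \in C} T(x)$, then $T$ has a fixed point in $C$, i.e. there exists $x \in C$ with $x \in T(x)$.
   Context: $2^{\mathbb{R}}$ denotes the set of all subsets of $\mathbb{R}$. A set-valued mapping $T : C \to 2^{\mathbb{R}}$ is upper semicontinuous if for each $x \in C$ and each open $V \subseteq \mathbb{R}$ with $T(x) \subseteq V$, there is an open neighborhood $U$ of $x$ in $C$ such that $T(y) \subseteq V$ for all $y \in U$. *)

theory Defs
  imports "HOL-Analysis.Analysis"
begin

(* A set-valued mapping C -> 2^Y is a total function of which only the values on C matter.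
   Neighbourhoods of x are open in the subspace topology of C; V is open in the whole target. *)
definition upper_semicontinuous_on ::
    "'a::topological_space set \<Rightarrow> ('a \<Rightarrow> 'b::topological_space set) \<Rightarrow> bool" where
  "upper_semicontinuous_on C T \<longleftrightarrow>
     (\<forall>x\<in>C. \<forall>V. open V \<and> T x \<subseteq> V \<longrightarrow>
        (\<exists>U. openin (top_of_set C) U \<and> x \<in> U \<and> (\<forall>y\<in>U. T y \<subseteq> V)))"

end

theory Submission
  imports Defs
begin

text \<open>If \<open>x \<notin> T x\<close> throughout \<open>C\<close>, convexity puts each \<open>T x\<close> entirely to the right or entirely to
  the left of \<open>x\<close>. Upper semicontinuity makes both alternatives open in \<open>C\<close>, so by connectedness one
  of them holds on all of \<open>C\<close>; then \<open>T\<close> misses the minimum, respectively the maximum, of \<open>C\<close>.\<close>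

text \<open>Upper semicontinuity controls \<open>T y\<close> only against a fixed open
  \<open>V\<close>, whereas the slice of \<open>G\<close> over \<open>y\<close> moves with
  \<open>y\<close>. Compactness of \<open>T x\<close> bridges this: the tube lemma fits a box
  \<open>U \<times> V\<close> between \<open>{x} \<times> T x\<close> and \<open>G\<close>.\<close>

lemma openin_upper_semicontinuous_Sigma_subset:
  fixes C :: "'a::topological_space set" and T :: "'a \<Rightarrow> 'b::topological_space set"
  assumes usc: "upper_semicontinuous_on C T"
    and compact: "\<And>x. x \<in> C \<Longrightarrow> compact (T x)"
    and G: "open G"
  shows "openin (top_of_set C) {x \<in> C. {x} \<times> T x \<subseteq> G}"
proof (subst openin_subopen, intro ballI)
  fix x assume "x \<in> {x \<in> C. {x} \<times> T x \<subseteq> G}"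
  then have x: "x \<in> C" "{x} \<times> T x \<subseteq> G"
    by auto
  obtain U V where UV: "open U" "open V" "{x} \<subseteq> U" "T x \<subseteq> V" "U \<times> V \<subseteq> G"
    using Wallace_theorem_prod_topology[of euclidean "{x}" euclidean "T x" G] x compact G
    by (auto simp: open_openin[symmetric] compactin_euclidean_iff euclidean_product_topology)
  from usc x(1) UV(2,4) obtain W where
    W: "openin (top_of_set C) W" "x \<in> W" "\<forall>y\<in>W. T y \<subseteq> V"
    unfolding upper_semicontinuous_on_def by blast
  show "\<exists>S. openin (top_of_set C) S \<and> x \<in> S \<and> S \<subseteq> {x \<in> C. {x} \<times> T x \<subseteq> G}"
  proof (intro exI conjI)
    \<comment> \<open>\<open>U\<close> keeps the first coordinate in the box, \<open>W\<close> keeps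
      the values of \<open>T\<close> in \<open>V\<close>.\<close>
    show "openin (top_of_set C) (W \<inter> U)"
      using W(1) UV(1) by (rule openin_Int_open)
    show "x \<in> W \<inter> U"
      using W UV by auto
    show "W \<inter> U \<subseteq> {x \<in> C. {x} \<times> T x \<subseteq> G}"
      using openin_imp_subset[OF W(1)] W(3) UV(5) by blast
  qed
qed

text \<open>Otherwise \<open>S\<close> has points weakly on both sides of \<open>x\<close>, and a
  convex set of reals, being an interval, would contain \<open>x\<close>.\<close>

lemma convex_not_mem_real_cases:
  fixes S :: "real set"
  assumes "convex S" "x \<notin> S"
  shows "S \<subseteq> {x<..} \<or> S \<subseteq> {..<x}"
proof (rule ccontr)
  assume "\<not> ?thesis"
  then obtain u v where "u \<in> S" "v \<in> S" "u \<le> x" "x \<le> v"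
    by (simp add: subset_eq not_less) blast
  then show False
    using assms mem_is_interval_1_I[of S u v x] is_interval_convex_1 by blast
qed

theorem theorem2p2:
  fixes C :: "real set" and T :: "real \<Rightarrow> real set"
  assumes "C \<noteq> {}" and "convex C" and "compact C"
    and "upper_semicontinuous_on C T"
    and "\<And>x. x \<in> C \<Longrightarrow> T x \<noteq> {} \<and> compact (T x) \<and> convex (T x)"
    and "C \<subseteq> (\<Union>x\<in>C. T x)"
  shows "\<exists>x\<in>C. x \<in> T x"
proof (rule ccontr)
  assume no_fix: "\<not> ?thesis"
  \<comment> \<open>The graph over \<open>x\<close> lies above the diagonal for \<open>R\<close> and
    below it for \<open>L\<close>; both half-planes are open.\<close>
  define R where "R = {x \<in> C. {x} \<times> T x \<subseteq> {p. fst p < snd p}}"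
  define L where "L = {x \<in> C. {x} \<times> T x \<subseteq> {p. snd p < fst p}}"
  have "openin (top_of_set C) R" "openin (top_of_set C) L"
    unfolding R_def L_def using assms(4,5)
    by (auto intro!: openin_upper_semicontinuous_Sigma_subset open_Collect_less continuous_intros)
  moreover have "C \<subseteq> R \<union> L"
  proof
    fix x assume "x \<in> C"
    then show "x \<in> R \<union> L"
      using convex_not_mem_real_cases[of "T x" x] assms(5) no_fix
      unfolding R_def L_def by fastforce
  qed
  \<comment> \<open>Nonemptiness of \<open>T x\<close> enters here: any value would be both above
    and below \<open>x\<close>.\<close>
  moreover have "R \<inter> L = {}"
    using assms(5) unfolding R_def L_def by fastforce
  ultimately have "R = {} \<or> L = {}"
    using convex_connected[OF assms(2)] unfolding connected_openin by blast
  then consider "C \<subseteq> R" | "C \<subseteq> L"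
    using \<open>C \<subseteq> R \<union> L\<close> by blast
  then show False
  proof cases
    case 1
    obtain a where a: "a \<in> C" "\<forall>y\<in>C. a \<le> y"
      using compact_attains_inf assms(1,3) by blast
    obtain x where "x \<in> C" "a \<in> T x"
      using assms(6) a(1) by blast
    \<comment> \<open>Membership of \<open>x\<close> in \<open>R\<close> gives \<open>x < a\<close>,
      against minimality of \<open>a\<close>.\<close>
    then show False
      using 1 a(2) unfolding R_def by fastforce
  next
    case 2
    obtain b where b: "b \<in> C" "\<forall>y\<in>C. y \<le> b"
      using compact_attains_sup assms(1,3) by blast
    obtain x where "x \<in> C" "b \<in> T x"
      using assms(6) b(1) by blast
    then show False
      using 2 b(2) unfolding L_def by fastforce
  qed
qed

end
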